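(* Let $(A,D(A))$ be a closed and densely defined operator on a complex Banach space $X$, with spectrum $\sigma(A)$ and numerical spectrum $\sigma_n(A)$. Then the following hold. (1) $\sigma(A)\subseteq\sigma_n(A)$. (2) If $A$ is a bounded operator, then $\sigma_n(A)\subseteq\{\lambda\in\mathbb{C}:|\lambda|\le\|A\|\}$.
   Context: For $\theta\in[0,2\pi)$ and $\omega\in\mathbb{R}$ let $H_{\theta,\omega}:=\{e^{i\theta}\lambda:\ \lambda\in\mathbb{C},\ \mathrm{Re}\,\lambda>\omega\}$, an open half plane with boundary $\partial H_{\theta,\omega}$, and let $d(\lambda,\partial H_{\theta,\omega}):=\inf\{|\lambda-\mu|:\mu\in\partial H_{\theta,\omega}\}$. For a closed, densely defined operator $(A,D(A))$ with resolvent set $\rho(A)$ and resolvent $R(\lambda,A)=(\lambda-A)^{-1}$, the numerical resolvent set $\rho_n(A)$ is the union of all open half planes $H_{\theta,\omega}$ (with $\theta\in[0,2\pi)$, $\omega\in\mathbb{R}$) such that $H_{\theta,\omega}\subseteq\rho(A)$ and $\|R(\lambda,A)\|\le \frac{1}{d(\lambda,\partial H_{\theta,\omega})}$ for all $\lambda\in H_{\theta,\omega}$. The numerical spectrum is $\sigma_n(A):=\mathbb{C}\setminus\rho_n(A)$. *)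

theory Defs
  imports "HOL-Analysis.Analysis"
begin

(* The distribution only has real Banach spaces. A complex Banach space is a real one with a
   compatible complex scalar multiplication for which the norm is homogeneous. *)

class scaleC =
  fixes scaleC :: "complex \<Rightarrow> 'a \<Rightarrow> 'a" (infixr "*\<^sub>C" 75)

class complex_vector = scaleC + real_vector +
  assumes scaleC_add_right: "a *\<^sub>C (x + y) = a *\<^sub>C x + a *\<^sub>C y"
    and scaleC_add_left: "(a + b) *\<^sub>C x = a *\<^sub>C x + b *\<^sub>C x"
    and scaleC_scaleC: "a *\<^sub>C b *\<^sub>C x = (a * b) *\<^sub>C x"
    and scaleC_one: "1 *\<^sub>C x = x"
    and scaleR_scaleC: "r *\<^sub>R x = complex_of_real r *\<^sub>C x"

class complex_normed_vector = complex_vector + real_normed_vector +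
  assumes norm_scaleC: "norm (a *\<^sub>C x) = cmod a * norm x"

class complex_banach = complex_normed_vector + banach

global_interpretation complex_vector:
  vector_space "scaleC :: complex \<Rightarrow> 'a \<Rightarrow> 'a::complex_vector"
  by unfold_locales (rule scaleC_add_right scaleC_add_left scaleC_scaleC scaleC_one)+

instantiation complex :: complex_banach
begin

definition scaleC_complex :: "complex \<Rightarrow> complex \<Rightarrow> complex"
  where "scaleC_complex a x = a * x"

instance
  by standard (simp_all add: scaleC_complex_def algebra_simps scaleR_conv_of_real norm_mult)

end

(* An unbounded operator is given by its domain D and a function A, of which only the values
   on D are relevant. *)

definition operator_on :: "'a::complex_vector set \<Rightarrow> ('a \<Rightarrow> 'a) \<Rightarrow> bool" where
  "operator_on D A \<longleftrightarrow> complex_vector.subspace D \<and>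
     (\<forall>x\<in>D. \<forall>y\<in>D. A (x + y) = A x + A y) \<and>
     (\<forall>c. \<forall>x\<in>D. A (c *\<^sub>C x) = c *\<^sub>C A x)"

definition closed_operator :: "'a::complex_normed_vector set \<Rightarrow> ('a \<Rightarrow> 'a) \<Rightarrow> bool" where
  "closed_operator D A \<longleftrightarrow> operator_on D A \<and> closed {(x, A x) |x. x \<in> D}"

definition densely_defined :: "'a::topological_space set \<Rightarrow> bool" where
  "densely_defined D \<longleftrightarrow> closure D = UNIV"

definition bounded_operator :: "'a::complex_normed_vector set \<Rightarrow> ('a \<Rightarrow> 'a) \<Rightarrow> bool" where
  "bounded_operator D A \<longleftrightarrow> operator_on D A \<and> (\<exists>K. \<forall>x\<in>D. norm (A x) \<le> K * norm x)"

(* For D = UNIV this is onorm A. *)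
definition operator_norm :: "'a::complex_normed_vector set \<Rightarrow> ('a \<Rightarrow> 'a) \<Rightarrow> real" where
  "operator_norm D A = (SUP x\<in>D. norm (A x) / norm x)"

definition resolvent :: "complex \<Rightarrow> 'a::complex_vector set \<Rightarrow> ('a \<Rightarrow> 'a) \<Rightarrow> 'a \<Rightarrow> 'a" where
  "resolvent z D A = inv_into D (\<lambda>x. z *\<^sub>C x - A x)"

(* For closed A the boundedness of the inverse follows from the closed graph theorem. *)
definition resolvent_set :: "'a::complex_normed_vector set \<Rightarrow> ('a \<Rightarrow> 'a) \<Rightarrow> complex set" where
  "resolvent_set D A =
     {z. bij_betw (\<lambda>x. z *\<^sub>C x - A x) D UNIV \<and> bounded_linear (resolvent z D A)}"

definition spectrum :: "'a::complex_normed_vector set \<Rightarrow> ('a \<Rightarrow> 'a) \<Rightarrow> complex set" where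
  "spectrum D A = UNIV - resolvent_set D A"

definition half_plane :: "real \<Rightarrow> real \<Rightarrow> complex set" where
  "half_plane \<theta> \<omega> = {exp (\<i> * complex_of_real \<theta>) * z |z. Re z > \<omega>}"

definition numerical_resolvent_set ::
    "'a::complex_normed_vector set \<Rightarrow> ('a \<Rightarrow> 'a) \<Rightarrow> complex set" where
  "numerical_resolvent_set D A =
     \<Union>{half_plane \<theta> \<omega> |\<theta> \<omega>. \<theta> \<in> {0..<2 * pi} \<and>
        half_plane \<theta> \<omega> \<subseteq> resolvent_set D A \<and>
        (\<forall>z\<in>half_plane \<theta> \<omega>.
           onorm (resolvent z D A) \<le> 1 / infdist z (frontier (half_plane \<theta> \<omega>)))}"

definition numerical_spectrum ::
    "'a::complex_normed_vector set \<Rightarrow> ('a \<Rightarrow> 'a) \<Rightarrow> complex set" where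
  "numerical_spectrum D A = UNIV - numerical_resolvent_set D A"

end

theory Submission
  imports Defs
begin

text \<open>
  For the first claim, \<open>numerical_resolvent_set\<close> is a union of half planes that lie in the
  resolvent set, so complements are reversed.

  For the second claim, a bounded operator that is closed and densely defined has domain \<open>UNIV\<close>
  (the domain is closed under limits, as the operator maps Cauchy sequences to Cauchy sequences).
  Let \<open>N\<close> be the norm of \<open>A\<close>. For \<open>cmod w > N\<close> the equation \<open>w x - A x = y\<close> says that \<open>x\<close> is a
  fixed point of \<open>x \<mapsto> (y + A x) / w\<close>, a contraction with constant \<open>N / cmod w\<close>, and
  \<open>norm (w x - A x) \<ge> (cmod w - N) * norm x\<close> bounds the resolvent by \<open>1 / (cmod w - N)\<close>
  (lemma \<open>resolvent_of_bounded_operator\<close>).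
  A point \<open>z\<close> of argument \<open>\<theta>\<close> with \<open>cmod z > N\<close> lies in \<open>half_plane \<theta> N\<close>. This half plane
  avoids the closed disc of radius \<open>N\<close>, and its boundary touches the disc, so that
  every \<open>w\<close> in it has distance at most \<open>cmod w - N\<close> from the boundary
  (lemma \<open>half_plane_infdist\<close>). Hence the resolvent bound on the half plane is the one that the
  numerical resolvent set asks for.
\<close>

lemma half_plane_eq_halfspace: "half_plane \<theta> \<omega> = {w. cis \<theta> \<bullet> w > \<omega>}"
proof -
  have *: "cis \<theta> \<bullet> w = Re (cis (-\<theta>) * w)" for w
    by (simp add: inner_complex_def)
  have "w = exp (\<i> * complex_of_real \<theta>) * z \<longleftrightarrow> z = cis (-\<theta>) * w" for w z
    by (auto simp: cis_conv_exp[symmetric] mult.assoc[symmetric] cis_mult)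
  then show ?thesis
    unfolding half_plane_def * by simp
qed

text \<open>
  The distance is attained at the foot of the perpendicular, and Cauchy-Schwarz compares it with
  the modulus. Strict positivity matters as well: at distance \<open>0\<close> the bound \<open>1 / infdist\<close> would
  take the default value \<open>0\<close>.
\<close>

lemma half_plane_infdist:
  assumes "w \<in> half_plane \<theta> \<omega>"
  shows "0 < infdist w (frontier (half_plane \<theta> \<omega>))"
    and "infdist w (frontier (half_plane \<theta> \<omega>)) \<le> cmod w - \<omega>"
proof -
  define a where "a = cis \<theta>"
  have a: "norm a = 1" "a \<bullet> a = 1"
    by (simp_all add: a_def dot_square_norm)
  have w: "a \<bullet> w > \<omega>"
    using assms by (simp add: half_plane_eq_halfspace a_def)
  have "a \<noteq> 0" using a by auto
  then have fr: "frontier (half_plane \<theta> \<omega>) = {x. a \<bullet> x = \<omega>}"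
    unfolding half_plane_eq_halfspace a_def[symmetric] by (simp add: frontier_halfspace_gt)
  let ?p = "w - (a \<bullet> w - \<omega>) *\<^sub>R a"
  have p: "?p \<in> {x. a \<bullet> x = \<omega>}"
    using a by (simp add: inner_diff_right)
  have "infdist w {x. a \<bullet> x = \<omega>} \<le> dist w ?p"
    using p by (rule infdist_le)
  also have "\<dots> = a \<bullet> w - \<omega>"
    using a w by (simp add: dist_norm)
  also have "\<dots> \<le> cmod w - \<omega>"
    using norm_cauchy_schwarz[of a w] a by simp
  finally show "infdist w (frontier (half_plane \<theta> \<omega>)) \<le> cmod w - \<omega>"
    using fr by simp
  have "{x. a \<bullet> x = \<omega>} \<noteq> {}" "w \<notin> {x. a \<bullet> x = \<omega>}"
    using p w by auto
  then show "0 < infdist w (frontier (half_plane \<theta> \<omega>))"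
    unfolding fr by (intro infdist_pos_not_in_closed closed_hyperplane)
qed

lemma closed_bounded_dense_operator_domain:
  fixes D :: "'a::complex_banach set"
  assumes cl: "closed_operator D A" and bd: "bounded_operator D A" and dense: "densely_defined D"
  shows "D = UNIV"
proof -
  obtain K where K: "\<And>x. x \<in> D \<Longrightarrow> norm (A x) \<le> K * norm x"
    and op: "operator_on D A"
    using bd by (auto simp: bounded_operator_def)
  have diff: "x - y \<in> D" "A (x - y) = A x - A y" if "x \<in> D" "y \<in> D" for x y
  proof -
    show "x - y \<in> D"
      using op that complex_vector.subspace_diff by (auto simp: operator_on_def)
    then have "A ((x - y) + y) = A (x - y) + A y"
      using op that unfolding operator_on_def by blast
    then show "A (x - y) = A x - A y" by simp
  qed
  have "x \<in> D" for x
  proof -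
    have "x \<in> closure D" using dense by (simp add: densely_defined_def)
    then obtain s where s: "\<And>n. s n \<in> D" "s \<longlonglongrightarrow> x"
      by (auto simp: closure_sequential)
    have bound: "dist (A (s m)) (A (s n)) \<le> (\<bar>K\<bar> + 1) * dist (s m) (s n)" for m n
    proof -
      have "dist (A (s m)) (A (s n)) \<le> K * norm (s m - s n)"
        using K[OF diff(1)[OF s(1)[of m] s(1)[of n]]] diff(2)[OF s(1)[of m] s(1)[of n]]
        by (simp add: dist_norm)
      also have "\<dots> \<le> (\<bar>K\<bar> + 1) * norm (s m - s n)"
        by (intro mult_right_mono) auto
      finally show ?thesis by (simp add: dist_norm)
    qed
    have "Cauchy (\<lambda>n. A (s n))"
    proof (rule metric_CauchyI)
      fix e :: real assume "e > 0"
      then have "e / (\<bar>K\<bar> + 1) > 0" by (simp add: add_nonneg_pos)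
      with LIMSEQ_imp_Cauchy[OF s(2)] obtain M
        where M: "\<And>m n. m \<ge> M \<Longrightarrow> n \<ge> M \<Longrightarrow> dist (s m) (s n) < e / (\<bar>K\<bar> + 1)"
        unfolding Cauchy_def by blast
      have "dist (A (s m)) (A (s n)) < e" if "m \<ge> M" "n \<ge> M" for m n
      proof -
        have "(\<bar>K\<bar> + 1) * dist (s m) (s n) < e"
          using M[OF that] by (simp add: pos_less_divide_eq add_nonneg_pos mult.commute)
        then show ?thesis using bound[of m n] by simp
      qed
      then show "\<exists>M. \<forall>m\<ge>M. \<forall>n\<ge>M. dist (A (s m)) (A (s n)) < e" by blast
    qed
    then obtain y where y: "(\<lambda>n. A (s n)) \<longlonglongrightarrow> y"
      using Cauchy_convergent convergent_def by blast
    have "(x, y) \<in> {(x, A x) |x. x \<in> D}"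
    proof (rule closed_sequentially[where f = "\<lambda>n. (s n, A (s n))"])
      show "closed {(x, A x) |x. x \<in> D}" using cl by (simp add: closed_operator_def)
      show "(\<lambda>n. (s n, A (s n))) \<longlonglongrightarrow> (x, y)" using s(2) y by (rule tendsto_Pair)
    qed (use s in auto)
    then show ?thesis by auto
  qed
  then show ?thesis by auto
qed

lemma operator_norm_bound:
  fixes D :: "'a::complex_normed_vector set"
  assumes "bounded_operator D A"
  shows "0 \<le> operator_norm D A"
    and "x \<in> D \<Longrightarrow> norm (A x) \<le> operator_norm D A * norm x"
proof -
  obtain K where K: "\<And>x. x \<in> D \<Longrightarrow> norm (A x) \<le> K * norm x" and op: "operator_on D A"
    using assms by (auto simp: bounded_operator_def)
  have "norm (A x) / norm x \<le> \<bar>K\<bar>" if "x \<in> D" for x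
    using K[OF that] by (cases "x = 0") (auto simp: divide_simps intro: order_trans mult_right_mono)
  then have bdd: "bdd_above ((\<lambda>x. norm (A x) / norm x) ` D)"
    by (intro bdd_aboveI2)
  have le: "norm (A x) / norm x \<le> operator_norm D A" if "x \<in> D" for x
    unfolding operator_norm_def using bdd that by (rule cSUP_upper2) simp
  have "0 \<in> D"
    using op complex_vector.subspace_0 by (auto simp: operator_on_def)
  then show "0 \<le> operator_norm D A" using le by force
  show "norm (A x) \<le> operator_norm D A * norm x" if "x \<in> D"
    using le[OF that] K[OF that] by (cases "x = 0") (auto simp: divide_simps)
qed

text \<open>
  Surjectivity comes from the contraction principle; injectivity and the norm estimate both come
  from \<open>norm (w x - A x) \<ge> (cmod w - N) * norm x\<close>.
\<close>

lemma resolvent_of_bounded_operator: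
  fixes A :: "'a::complex_banach \<Rightarrow> 'a"
  assumes op: "operator_on UNIV A" and A: "\<And>x. norm (A x) \<le> N * norm x"
    and "0 \<le> N" and w: "N < cmod w"
  shows "w \<in> resolvent_set UNIV A" and "onorm (resolvent w UNIV A) \<le> 1 / (cmod w - N)"
proof -
  define f where "f = (\<lambda>x. w *\<^sub>C x - A x)"
  define R where "R = resolvent w UNIV A"
  have A_add: "A (x + y) = A x + A y" and A_scale: "A (c *\<^sub>C x) = c *\<^sub>C A x" for x y c
    using op by (auto simp: operator_on_def)
  have A_diff: "A (x - y) = A x - A y" for x y
    using A_add[of "x - y" y] by simp
  have w0: "w \<noteq> 0" using assms by auto
  have f_add: "f (x + y) = f x + f y" for x y
    by (simp add: f_def A_add scaleC_add_right)
  have f_scaleR: "f (r *\<^sub>R x) = r *\<^sub>R f x" for r x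
    by (simp add: f_def A_scale scaleR_scaleC complex_vector.scale_right_diff_distrib
        scaleC_scaleC mult.commute)
  have lower: "(cmod w - N) * norm x \<le> norm (f x)" for x
    using norm_triangle_ineq2[of "w *\<^sub>C x" "A x"] A[of x]
    by (simp add: f_def norm_scaleC algebra_simps)
  have inj: "inj f"
  proof (rule injI)
    fix x y assume "f x = f y"
    moreover have "f (x - y) + f y = f x" using f_add[of "x - y" y] by simp
    ultimately have "(cmod w - N) * norm (x - y) \<le> 0" using lower[of "x - y"] by simp
    then show "x = y" using w by (simp add: mult_le_0_iff)
  qed
  have surj: "surj f"
    unfolding surj_def
  proof
    fix y
    let ?g = "\<lambda>x. inverse w *\<^sub>C (y + A x)"
    have "\<exists>!x. ?g x = x"
    proof (rule banach_fix_type)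
      show "0 \<le> N / cmod w" "N / cmod w < 1" using assms w0 by auto
      show "\<forall>x x'. dist (?g x) (?g x') \<le> N / cmod w * dist x x'"
      proof (intro allI)
        fix x x'
        have "?g x - ?g x' = inverse w *\<^sub>C A (x - x')"
          by (simp add: A_diff flip: complex_vector.scale_right_diff_distrib)
        then have "dist (?g x) (?g x') = norm (A (x - x')) / cmod w"
          by (simp add: dist_norm norm_scaleC norm_inverse divide_inverse mult.commute)
        also have "\<dots> \<le> N / cmod w * dist x x'"
          using divide_right_mono[OF A[of "x - x'"], of "cmod w"] by (simp add: dist_norm)
        finally show "dist (?g x) (?g x') \<le> N / cmod w * dist x x'" .
      qed
    qed
    then obtain x where x: "?g x = x" by (rule ex1E)
    have "w *\<^sub>C x = w *\<^sub>C ?g x" by (simp only: x)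
    also have "\<dots> = y + A x" using w0 by (simp add: scaleC_scaleC scaleC_one)
    finally have "y = f x" by (simp add: f_def)
    then show "\<exists>x. y = f x" ..
  qed
  have R: "R = inv f" by (simp add: R_def resolvent_def f_def)
  have fR: "f (R y) = y" for y using surj by (simp add: R surj_f_inv_f)
  have R_bound: "norm (R y) \<le> 1 / (cmod w - N) * norm y" for y
    using lower[of "R y"] w by (simp add: fR field_simps)
  have "bounded_linear R"
  proof (rule bounded_linear_intro)
    show "R (x + y) = R x + R y" for x y
      using inj by (rule injD) (simp add: f_add fR)
    show "R (r *\<^sub>R x) = r *\<^sub>R R x" for r x
      using inj by (rule injD) (simp add: f_scaleR fR)
    show "norm (R x) \<le> norm x * (1 / (cmod w - N))" for x
      using R_bound[of x] by (simp add: mult.commute)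
  qed
  then show "w \<in> resolvent_set UNIV A"
    using inj surj by (simp add: resolvent_set_def bij_def R_def f_def)
  show "onorm (resolvent w UNIV A) \<le> 1 / (cmod w - N)"
    unfolding R_def[symmetric] using w R_bound by (intro onorm_bound) auto
qed

lemma numerical_spectrum_subset_disc:
  fixes A :: "'a::complex_banach \<Rightarrow> 'a"
  assumes "bounded_operator UNIV A"
  shows "numerical_spectrum UNIV A \<subseteq> {z. cmod z \<le> operator_norm UNIV A}"
proof -
  define N where "N = operator_norm UNIV A"
  have op: "operator_on UNIV A" using assms by (simp add: bounded_operator_def)
  note N = operator_norm_bound[OF assms, folded N_def, simplified]
  have "z \<in> numerical_resolvent_set UNIV A" if z: "N < cmod z" for z
  proof -
    define \<theta> where "\<theta> = Arg2pi z"
    have \<theta>: "\<theta> \<in> {0..<2 * pi}"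
      using Arg2pi_ge_0 Arg2pi_lt_2pi by (simp add: \<theta>_def)
    have "z = exp (\<i> * complex_of_real \<theta>) * complex_of_real (cmod z)"
      using Arg2pi_eq[of z] by (simp add: \<theta>_def mult.commute)
    then have z_in: "z \<in> half_plane \<theta> N"
      using z unfolding half_plane_def by (metis (mono_tags, lifting) Re_complex_of_real mem_Collect_eq)
    have *: "w \<in> resolvent_set UNIV A \<and>
        onorm (resolvent w UNIV A) \<le> 1 / infdist w (frontier (half_plane \<theta> N))"
      if "w \<in> half_plane \<theta> N" for w
    proof -
      note d = half_plane_infdist[OF that]
      have w: "N < cmod w" using d by linarith
      note r = resolvent_of_bounded_operator[OF op N(2) N(1) w]
      have "1 / (cmod w - N) \<le> 1 / infdist w (frontier (half_plane \<theta> N))"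
        using d by (intro divide_left_mono mult_pos_pos) auto
      then show ?thesis using r by linarith
    qed
    show ?thesis
      unfolding numerical_resolvent_set_def using \<theta> z_in * by blast
  qed
  then show ?thesis
    unfolding numerical_spectrum_def N_def by force
qed

theorem proposition2p4:
  fixes D :: "'a::complex_banach set" and A :: "'a \<Rightarrow> 'a"
  assumes "closed_operator D A" and "densely_defined D"
  shows "spectrum D A \<subseteq> numerical_spectrum D A \<and>
    (bounded_operator D A \<longrightarrow>
       numerical_spectrum D A \<subseteq> {z. cmod z \<le> operator_norm D A})"
proof (intro conjI impI)
  show "spectrum D A \<subseteq> numerical_spectrum D A"
    unfolding spectrum_def numerical_spectrum_def numerical_resolvent_set_def by blast
  assume bd: "bounded_operator D A"
  then have "D = UNIV"
    using assms closed_bounded_dense_operator_domain by blast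
  then show "numerical_spectrum D A \<subseteq> {z. cmod z \<le> operator_norm D A}"
    using bd numerical_spectrum_subset_disc by blast
qed

end
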